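(* For every positive integer $t$ there is a planar graph $G_t$ of girth $4$ such that for every coloring of the vertices of $G_t$ with two colors, $G_t$ contains a monochromatic path of length $t-1$.
   Context: The colorings are arbitrary (not necessarily proper) maps from $V(G_t)$ to a set of two colors. A monochromatic path is a path all of whose vertices have the same color; its length is its number of edges. The girth of a graph is the length of its shortest cycle. *)

theory Defs
  imports
    "HOL-Analysis.Analysis"
    "HOL-Library.Extended_Nat"
    "Graph_Theory.Graph_Theory"
begin

text \<open>
  A finite simple undirected graph is a \<^locale>\<open>pair_graph\<close>: a finite, loop-free, symmetric digraph
  in which each edge \<open>uv\<close> is represented by the two arcs \<open>(u, v)\<close> and \<open>(v, u)\<close>.
\<close>

text \<open>
  Traversing an edge back and forth is a \<^const>\<open>pre_digraph.cycle\<close> of length two in the symmetric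
  digraph, but not a cycle of the undirected graph; hence the bound on the length. The girth of a
  forest is \<open>\<infinity>\<close>.
\<close>

definition girth :: "'a pair_pre_digraph \<Rightarrow> enat" where
  "girth G = (INF p \<in> {p. pre_digraph.cycle G p \<and> 3 \<le> length p}. enat (length p))"

text \<open>
  The curve of an edge is indexed by its unordered pair of end vertices, so that the two arcs of an
  edge share one curve, traversed in either direction. The plane is \<^typ>\<open>complex\<close>.
\<close>

definition edge_interior :: "('a \<Rightarrow> complex) \<Rightarrow> ('a set \<Rightarrow> real \<Rightarrow> complex) \<Rightarrow> 'a \<Rightarrow> 'a \<Rightarrow> complex set" where
  "edge_interior pos \<gamma> u v = path_image (\<gamma> {u, v}) - {pos u, pos v}"

definition plane_drawing ::
    "'a pair_pre_digraph \<Rightarrow> ('a \<Rightarrow> complex) \<Rightarrow> ('a set \<Rightarrow> real \<Rightarrow> complex) \<Rightarrow> bool" where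
  "plane_drawing G pos \<gamma> \<longleftrightarrow>
     inj_on pos (pverts G) \<and>
     (\<forall>(u, v) \<in> parcs G.
        arc (\<gamma> {u, v}) \<and>
        {pathstart (\<gamma> {u, v}), pathfinish (\<gamma> {u, v})} = {pos u, pos v} \<and>
        edge_interior pos \<gamma> u v \<inter> pos ` pverts G = {}) \<and>
     (\<forall>(u, v) \<in> parcs G. \<forall>(x, y) \<in> parcs G. {u, v} \<noteq> {x, y} \<longrightarrow>
        edge_interior pos \<gamma> u v \<inter> path_image (\<gamma> {x, y}) = {})"

definition planar :: "'a pair_pre_digraph \<Rightarrow> bool" where
  "planar G \<longleftrightarrow> (\<exists>pos \<gamma>. plane_drawing G pos \<gamma>)"

definition monochromatic :: "('a \<Rightarrow> 'c) \<Rightarrow> 'a set \<Rightarrow> bool" where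
  "monochromatic f S \<longleftrightarrow> (\<forall>u \<in> S. \<forall>v \<in> S. f u = f v)"

definition has_monochromatic_path :: "'a pair_pre_digraph \<Rightarrow> ('a \<Rightarrow> 'c) \<Rightarrow> nat \<Rightarrow> bool" where
  "has_monochromatic_path G f k \<longleftrightarrow>
     (\<exists>u p v. pre_digraph.apath G u p v \<and> length p = k \<and>
        monochromatic f (set (pre_digraph.awalk_verts G u p)))"

end

theory Submission
  imports Defs
begin

text \<open>
  All graphs are two-page book embeddings: the vertices are natural numbers, placed on the real axis,
  and every edge is a parabola above or below the axis, so that planarity becomes the combinatorial
  condition that no two edges of a page interleave.

  Call a vertex \<open>z\<close> forced if it is joined to a common hub \<open>0\<close>. Let \<open>c\<close> be the
  colour of the hub and \<open>c'\<close> the other one. Either some forced vertex has colour \<open>c\<close>, or all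
  of them have colour \<open>c'\<close>. In the second case the rim (edges on the upper page) contains a long monochromatic path.
  Consider a rim edge \<open>b a\<close> with \<open>b\<close> coloured \<open>c\<close> and \<open>a\<close> coloured \<open>c'\<close>,
  and complete it to a 4-cycle \<open>b w z a\<close> with \<open>z\<close> forced. If \<open>w\<close> has colour
  \<open>c'\<close>, then \<open>w z a\<close> is monochromatic and one continues with the edge \<open>b w\<close>. Otherwise
  \<open>b w\<close> is monochromatic and one continues with \<open>w z\<close>. As \<open>z\<close> is forced, the next
  forced vertex must not be adjacent to it; so \<open>w z\<close> is completed to a 4-cycle \<open>w x y z\<close>
  without forced vertices \<open>x, y\<close>. One of its three new edges goes from \<open>c\<close> to
  \<open>c'\<close>, and the \<open>c\<close>-path can be continued up to the first such edge. Hence the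
  \<open>c\<close>-path never gets shorter, and between two extensions of it the \<open>c'\<close>-path grows.

  Attaching a copy of this wheel, by its hub, to every vertex of the graph constructed so far lets any
  monochromatic path be extended by one vertex, unless a long path is found in the new wheel.
  A homomorphism to the 5-cycle excludes triangles.
\<close>

section \<open>Noncrossing edge sets and monochromatic paths\<close>

text \<open>Pairs are directed upward and the quantifiers run over both orders of two edges, so one
  interleaving pattern suffices; nested edges and common ends remain allowed.\<close>

definition noncrossing :: "(nat \<times> nat) set \<Rightarrow> bool" where
  "noncrossing E \<longleftrightarrow>
     (\<forall>(p, q) \<in> E. p < q) \<and> (\<forall>(p, q) \<in> E. \<forall>(x, y) \<in> E. \<not> (p < x \<and> x < q \<and> q < y))"

text \<open>The set \<open>S\<close> confines the path, so that a vertex outside \<open>S\<close>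
  can be put in front of it. Asking only for at least \<open>k\<close> edges lets longer paths stand
  without trimming.\<close>

definition mono_path_from ::
    "(nat \<times> nat) set \<Rightarrow> (nat \<Rightarrow> bool) \<Rightarrow> nat set \<Rightarrow> nat \<Rightarrow> nat \<Rightarrow> bool" where
  "mono_path_from E g S x k \<longleftrightarrow>
     (\<exists>xs. distinct (x # xs) \<and> successively (\<lambda>u v. (u, v) \<in> E \<union> E\<inverse>) (x # xs) \<and>
        set (x # xs) \<subseteq> S \<and> (\<forall>u \<in> set xs. g u = g x) \<and> k \<le> length xs)"

lemma mono_path_from_mono:
  assumes "mono_path_from E g S x k" "E \<subseteq> E'" "S \<subseteq> S'" "k' \<le> k"
  shows "mono_path_from E' g S' x k'"
proof -
  obtain xs where xs: "distinct (x # xs)" "successively (\<lambda>u v. (u, v) \<in> E \<union> E\<inverse>) (x # xs)"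
    "set (x # xs) \<subseteq> S" "\<forall>u \<in> set xs. g u = g x" "k \<le> length xs"
    using assms(1) unfolding mono_path_from_def by blast
  have "successively (\<lambda>u v. (u, v) \<in> E' \<union> E'\<inverse>) (x # xs)"
    using xs(2) by (rule successively_mono) (use assms(2) in auto)
  then show ?thesis
    unfolding mono_path_from_def using xs assms(3,4) by (intro exI[of _ xs]) auto
qed

lemma mono_path_from_0: "x \<in> S \<Longrightarrow> mono_path_from E g S x 0"
  unfolding mono_path_from_def by (intro exI[of _ "[]"]) auto

lemma mono_path_from_Cons:
  assumes "mono_path_from E g S y k" "(x, y) \<in> E \<union> E\<inverse>" "g x = g y" "x \<notin> S" "insert x S \<subseteq> S'"
  shows "mono_path_from E g S' x (Suc k)"
proof -
  obtain xs where xs: "distinct (y # xs)" "successively (\<lambda>u v. (u, v) \<in> E \<union> E\<inverse>) (y # xs)"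
    "set (y # xs) \<subseteq> S" "\<forall>u \<in> set xs. g u = g y" "k \<le> length xs"
    using assms(1) unfolding mono_path_from_def by blast
  show ?thesis
    unfolding mono_path_from_def using xs assms(2-) by (intro exI[of _ "y # xs"]) auto
qed

lemma mono_path_from_map:
  assumes "mono_path_from E g S x k" "inj h" "\<And>u v. (u, v) \<in> E \<Longrightarrow> (h u, h v) \<in> E'"
    and "\<And>u. g u = g' (h u)"
  shows "mono_path_from E' g' (h ` S) (h x) k"
proof -
  obtain xs where xs: "distinct (x # xs)" "successively (\<lambda>u v. (u, v) \<in> E \<union> E\<inverse>) (x # xs)"
    "set (x # xs) \<subseteq> S" "\<forall>u \<in> set xs. g u = g x" "k \<le> length xs"
    using assms(1) unfolding mono_path_from_def by blast
  have "successively (\<lambda>u v. (u, v) \<in> E' \<union> E'\<inverse>) (map h (x # xs))"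
    unfolding successively_map using xs(2) by (rule successively_mono) (use assms(3) in auto)
  moreover have "distinct (map h (x # xs))"
    using xs(1) assms(2) by (simp only: distinct_map) (blast intro: inj_on_subset)
  ultimately show ?thesis
    unfolding mono_path_from_def using xs assms(4) by (intro exI[of _ "map h xs"]) auto
qed

section \<open>Nested 4-cycles and forced vertices\<close>

text \<open>A polygon dissected into quadrilaterals: each long edge closes a 4-cycle with the outer
  edges of its three thirds.\<close>

fun ternary :: "nat \<Rightarrow> nat \<Rightarrow> (nat \<times> nat) set" where
  "ternary 0 b = {(b, b + 1)}"
| "ternary (Suc n) b =
     insert (b, b + 3 ^ Suc n) (ternary n b \<union> ternary n (b + 3 ^ n) \<union> ternary n (b + 2 * 3 ^ n))"

text \<open>
  The forced vertices inside the interval \<open>[b, b + 3 ^ n]\<close>; the flag tells whether the right end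
  of the interval is forced itself, in which case its neighbours must not be.
\<close>

fun spokes :: "bool \<Rightarrow> nat \<Rightarrow> nat \<Rightarrow> nat set" where
  "spokes s 0 b = {}"
| "spokes False (Suc n) b = insert (b + 2 * 3 ^ n) (spokes False n b \<union> spokes True n (b + 3 ^ n))"
| "spokes True (Suc n) b =
     spokes False n b \<union> spokes False n (b + 3 ^ n) \<union> spokes True n (b + 2 * 3 ^ n)"

lemma ternary_outer: "(b, b + 3 ^ n) \<in> ternary n b"
  by (cases n) auto

lemma ternary_bounds: "(p, q) \<in> ternary n b \<Longrightarrow> b \<le> p \<and> p < q \<and> q \<le> b + 3 ^ n"
  by (induction n b rule: ternary.induct) force+

lemma ternary_parity: "(p, q) \<in> ternary n b \<Longrightarrow> even p \<longleftrightarrow> odd q"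
  by (induction n b rule: ternary.induct) auto

lemma spokes_bounds: "z \<in> spokes s n b \<Longrightarrow> b < z \<and> z < b + 3 ^ n"
  by (induction s n b rule: spokes.induct) force+

lemma noncrossingD:
  assumes "noncrossing E" "(p, q) \<in> E"
  shows "p < q" and "(x, y) \<in> E \<Longrightarrow> \<not> (p < x \<and> x < q \<and> q < y)"
  using assms unfolding noncrossing_def by blast+

lemma noncrossing_Un:
  assumes E: "noncrossing E" "noncrossing E'"
    and sep: "\<And>p q. (p, q) \<in> E \<Longrightarrow> q \<le> c" "\<And>p q. (p, q) \<in> E' \<Longrightarrow> c \<le> p"
  shows "noncrossing (E \<union> E')"
proof -
  have "\<not> (p < x \<and> x < q \<and> q < y)" if pq: "(p, q) \<in> E \<union> E'" and xy: "(x, y) \<in> E \<union> E'" for p q x y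
    using pq xy noncrossingD(2)[OF E(1), of p q x y] noncrossingD(2)[OF E(2), of p q x y]
      sep(1)[of p q] sep(2)[of p q] sep(1)[of x y] sep(2)[of x y]
      noncrossingD(1)[OF E(1), of x y] noncrossingD(1)[OF E(2), of p q] by auto
  moreover have "p < q" if "(p, q) \<in> E \<union> E'" for p q
    using that noncrossingD(1)[OF E(1), of p q] noncrossingD(1)[OF E(2), of p q] by auto
  ultimately show ?thesis
    unfolding noncrossing_def by blast
qed

lemma noncrossing_insert:
  assumes E: "noncrossing E" and "b < d" and sub: "\<And>p q. (p, q) \<in> E \<Longrightarrow> b \<le> p \<and> q \<le> d"
  shows "noncrossing (insert (b, d) E)"
proof -
  have "\<not> (p < x \<and> x < q \<and> q < y)"
    if "(p, q) \<in> insert (b, d) E" "(x, y) \<in> insert (b, d) E" for p q x y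
    using that noncrossingD(2)[OF E, of p q x y] sub[of p q] sub[of x y] by auto
  moreover have "p < q" if "(p, q) \<in> insert (b, d) E" for p q
    using that noncrossingD(1)[OF E, of p q] assms(2) by auto
  ultimately show ?thesis
    unfolding noncrossing_def by blast
qed

lemma noncrossing_ternary: "noncrossing (ternary n b)"
proof (induction n arbitrary: b)
  case 0
  then show ?case by (simp add: noncrossing_def)
next
  case (Suc n)
  have bounds: "b \<le> p \<and> q \<le> b + 3 ^ n" if "(p, q) \<in> ternary n b" for p q b
    using ternary_bounds[OF that] by simp
  have "noncrossing (ternary n b \<union> ternary n (b + 3 ^ n))"
    by (rule noncrossing_Un[OF Suc Suc, of _ _ "b + 3 ^ n"]) (use bounds in auto)
  moreover have "q \<le> b + 2 * 3 ^ n" if "(p, q) \<in> ternary n b \<union> ternary n (b + 3 ^ n)" for p q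
    using that bounds[of p q b] bounds[of p q "b + 3 ^ n"] by auto
  ultimately have "noncrossing (ternary n b \<union> ternary n (b + 3 ^ n) \<union> ternary n (b + 2 * 3 ^ n))"
    using bounds[of _ _ "b + 2 * 3 ^ n"] by (intro noncrossing_Un[OF _ Suc, of _ _ "b + 2 * 3 ^ n"]) auto
  moreover have "b \<le> p \<and> q \<le> b + 3 ^ Suc n"
    if "(p, q) \<in> ternary n b \<union> ternary n (b + 3 ^ n) \<union> ternary n (b + 2 * 3 ^ n)" for p q
    using that bounds[of p q b] bounds[of p q "b + 3 ^ n"] bounds[of p q "b + 2 * 3 ^ n"] by auto
  ultimately show ?case
    unfolding ternary.simps by (intro noncrossing_insert) auto
qed

text \<open>Both flags go through one induction, since \<open>spokes\<close> mixes them. For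
  \<open>False\<close>, the new spoke \<open>b + 2 * 3 ^ n\<close> is the right end of a third with
  flag \<open>True\<close> and the left end of a third without spokes. For \<open>True\<close>, the
  forced right end meets only the last third, whose flag is \<open>True\<close> again, and the outer
  edge, whose left end \<open>b\<close> is not forced.\<close>

lemma spokes_independent:
  assumes "(p, q) \<in> ternary n b"
  shows "p \<notin> spokes False n b \<or> q \<notin> spokes False n b"
    and "p \<notin> insert (b + 3 ^ n) (spokes True n b) \<or> q \<notin> insert (b + 3 ^ n) (spokes True n b)"
  using assms
proof (induction n arbitrary: b)
  case 0
  { case 1 then show ?case by simp next case 2 then show ?case by simp }
next
  case (Suc n)
  define N :: nat where "N = 3 ^ n"
  have N: "N > 0" "3 ^ n = N" "3 ^ Suc n = 3 * N" by (auto simp: N_def)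
  have sub: "b + N + N = b + 2 * N" "b + 2 * N + N = b + 3 * N" for b by auto
  have inner: "b < u" "u < b + N" if "u \<in> spokes s n b" for u s b
    using spokes_bounds[OF that] by (auto simp: N)
  have edges: "(p, q) = (b, b + 3 * N) \<or> (p, q) \<in> ternary n b \<and> b \<le> p \<and> p < q \<and> q \<le> b + N \<or>
      (p, q) \<in> ternary n (b + N) \<and> b + N \<le> p \<and> p < q \<and> q \<le> b + 2 * N \<or>
      (p, q) \<in> ternary n (b + 2 * N) \<and> b + 2 * N \<le> p \<and> p < q \<and> q \<le> b + 3 * N"
    if "(p, q) \<in> ternary (Suc n) b" for b
    using that ternary_bounds[of p q n b] ternary_bounds[of p q n "b + N"]
      ternary_bounds[of p q n "b + 2 * N"]
    by (auto simp: N)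
  { case (1 b)
    let ?w = "b + N" and ?z = "b + 2 * N" and ?a = "b + 3 * N"
    have mem: "u \<in> spokes False (Suc n) b \<longleftrightarrow>
        u = ?z \<or> u \<in> spokes False n b \<or> u \<in> spokes True n ?w" for u
      by (simp add: N)
    show ?case
      using edges[OF 1] Suc(1)[of b] Suc(2)[of ?w] N(1) inner[of p False b] inner[of q False b]
        inner[of p True ?w] inner[of q True ?w]
      unfolding mem N sub by auto
  next
    case (2 b)
    let ?w = "b + N" and ?z = "b + 2 * N" and ?a = "b + 3 * N"
    have mem: "u \<in> insert (b + 3 ^ Suc n) (spokes True (Suc n) b) \<longleftrightarrow>
        u = ?a \<or> u \<in> spokes False n b \<or> u \<in> spokes False n ?w \<or> u \<in> spokes True n ?z" for u
      by (simp add: N)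
    note inner' = inner[of p False b] inner[of q False b] inner[of p False ?w] inner[of q False ?w]
      inner[of p True ?z] inner[of q True ?z]
    consider "(p, q) = (b, ?a)" | "(p, q) \<in> ternary n b" "b \<le> p" "p < q" "q \<le> ?w"
      | "(p, q) \<in> ternary n ?w" "?w \<le> p" "p < q" "q \<le> ?z"
      | "(p, q) \<in> ternary n ?z" "?z \<le> p" "p < q" "q \<le> ?a"
      using edges[OF 2] by blast
    then show ?case
    proof cases
      case 1
      then show ?thesis unfolding mem using inner' N(1) by auto
    next
      case 2
      then show ?thesis unfolding mem using Suc(1)[of b] inner' N(1) by auto
    next
      case 3
      then show ?thesis unfolding mem using Suc(1)[of ?w] inner' N(1) by auto
    next
      case 4
      have "u \<notin> spokes False n b" "u \<notin> spokes False n ?w" if "?z \<le> u" for u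
        using inner(2)[of u False b] inner(2)[of u False ?w] that N(1) by auto
      moreover have "?z \<le> p" "?z \<le> q" using 4 by auto
      ultimately show ?thesis unfolding mem using Suc(2)[of ?z] 4(1) by (auto simp: N sub)
    qed }
qed

section \<open>Growing the two paths inside a ternary piece\<close>

context
  fixes E :: "(nat \<times> nat) set" and g :: "nat \<Rightarrow> bool" and c :: bool and K :: nat
begin

text \<open>
  The hypotheses on \<open>n\<close> encode the lexicographic measure: each of the at most \<open>m\<close>
  extensions of the path at \<open>b\<close> resets the required length \<open>i\<close> of the other path to
  \<open>K\<close>, at a cost of \<open>K + 2\<close> levels.
\<close>

lemma mono_path_from_ternary:
  assumes "ternary n b \<subseteq> E" "g b = c" "g (b + 3 ^ n) = (\<not> c)"
  shows "\<lbrakk>\<forall>z \<in> spokes False n b. g z = (\<not> c); m * (K + 2) + i \<le> n + K + 1\<rbrakk> \<Longrightarrow>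
           mono_path_from E g {b..b + 3 ^ n} b m \<or> mono_path_from E g {b..b + 3 ^ n} (b + 3 ^ n) i \<or>
           (\<exists>x. mono_path_from E g UNIV x K)"
    and "\<lbrakk>\<forall>z \<in> spokes True n b. g z = (\<not> c); m * (K + 2) \<le> n\<rbrakk> \<Longrightarrow>
           mono_path_from E g {b..b + 3 ^ n} b m \<or> (\<exists>x. mono_path_from E g UNIV x K)"
  using assms
proof (induction n arbitrary: b m i)
  case 0
  { case 1
    \<comment> \<open>The budget \<open>K + 1\<close> is below the cost \<open>K + 2\<close> of a
      single extension.\<close>
    then have "m = 0 \<or> i = 0" by (cases m; cases i) auto
    then show ?case by (auto intro: mono_path_from_0)
  next
    case 2
    then show ?case by (auto intro: mono_path_from_0) }
next
  case (Suc n)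
  define N :: nat where "N = 3 ^ n"
  have N: "N > 0" "3 ^ n = N" "3 ^ Suc n = 3 * N" by (auto simp: N_def)
  have sub: "b + N + N = b + 2 * N" "b + 2 * N + N = b + 3 * N" for b by auto
  { case (1 b m i)
    let ?w = "b + N" and ?z = "b + 2 * N" and ?a = "b + 3 * N"
    have E: "ternary n b \<subseteq> E" "ternary n ?w \<subseteq> E" "ternary n ?z \<subseteq> E" 
      using 1(3) by (auto simp: N)
    have gz: "g ?z = (\<not> c)" using 1(1) by (simp add: N)
    have edges: "(b, ?w) \<in> E" "(?w, ?z) \<in> E" "(?z, ?a) \<in> E"
      using E ternary_outer[of b n] ternary_outer[of ?w n] ternary_outer[of ?z n] by (auto simp: N sub)
    show ?case
    proof (cases "m = 0 \<or> i = 0")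
      case True
      then show ?thesis by (auto intro: mono_path_from_0)
    next
      case False
      then obtain m' i' where mi: "m = Suc m'" "i = Suc i'" by (metis not0_implies_Suc)
      show ?thesis
      proof (cases "g ?w = c")
        case True
        \<comment> \<open>The edge \<open>b ?w\<close> extends the path at \<open>b\<close>; paying
          \<open>K + 2\<close> for it leaves \<open>m' * (K + 2) \<le> n\<close>. The middle third
          has the forced right end \<open>?z\<close>, hence the statement for
          \<open>True\<close>.\<close>
        have "mono_path_from E g {?w..?z} ?w m' \<or> (\<exists>x. mono_path_from E g UNIV x K)"
          using Suc(2)[of ?w m'] 1 E True gz mi by (simp add: N sub)
        then show ?thesis
          using mono_path_from_Cons[of E g "{?w..?z}" ?w m' b "{b..?a}"] edges 1(4) True N(1)
          by (auto simp: N mi)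
      next
        case False
        have "mono_path_from E g {b..?w} b m \<or> mono_path_from E g {b..?w} ?w i' \<or>
           (\<exists>x. mono_path_from E g UNIV x K)"
          using Suc(1)[of b m i'] 1 E False mi by (simp add: N)
        \<comment> \<open>The other path gains the two edges \<open>?w ?z\<close> and
          \<open>?z ?a\<close>; one would do for \<open>i = Suc i'\<close>.\<close>
        moreover have "mono_path_from E g {b..?a} ?a i" if "mono_path_from E g {b..?w} ?w i'"
        proof -
          have "mono_path_from E g {b..?z} ?z (Suc i')"
            by (rule mono_path_from_Cons[OF that]) (use edges gz False N(1) in auto)
          then have "mono_path_from E g {b..?a} ?a (Suc (Suc i'))"
            by (rule mono_path_from_Cons) (use edges gz 1(5) N in auto)
          then show ?thesis by (rule mono_path_from_mono) (auto simp: mi)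
        qed
        ultimately show ?thesis
          using mono_path_from_mono[of E g "{b..?w}" b m E "{b..?a}" m] by (auto simp: N)
      qed
    qed
  next
    case (2 b m)
    let ?w = "b + N" and ?z = "b + 2 * N" and ?a = "b + 3 * N"
    have E: "ternary n b \<subseteq> E" "ternary n ?w \<subseteq> E" "ternary n ?z \<subseteq> E" 
      using 2(3) by (auto simp: N)
    have edges: "(b, ?w) \<in> E" "(?w, ?z) \<in> E" "(?z, ?a) \<in> E"
      using E ternary_outer[of b n] ternary_outer[of ?w n] ternary_outer[of ?z n] by (auto simp: N sub)
    have sp: "\<forall>z \<in> spokes False n b. g z = (\<not> c)" "\<forall>z \<in> spokes False n ?w. g z = (\<not> c)"
      "\<forall>z \<in> spokes True n ?z. g z = (\<not> c)"
      using 2(1) by (auto simp: N)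
    have long: "\<exists>x. mono_path_from E g UNIV x K" if "mono_path_from E g S x K" for S x
      using mono_path_from_mono[OF that, of E UNIV K] by auto
    show ?case
    proof (cases m)
      case 0
      then show ?thesis by (auto intro: mono_path_from_0)
    next
      case m: (Suc m')
      \<comment> \<open>The cases say which of the edges \<open>b ?w\<close>, \<open>?w ?z\<close>,
        \<open>?z ?a\<close> is the first to leave colour \<open>c\<close>.\<close>
      consider "g ?w = (\<not> c)" | "g ?w = c" "g ?z = (\<not> c)" | "g ?w = c" "g ?z = c" by auto
      then show ?thesis
      proof cases
        case 1
        \<comment> \<open>Resetting \<open>i\<close> to \<open>K\<close> turns the numeric premise
          of the first statement at level \<open>n\<close> into
          \<open>m * (K + 2) \<le> Suc n\<close>, the present hypothesis.\<close>
        have "mono_path_from E g {b..?w} b m \<or> mono_path_from E g {b..?w} ?w K \<or>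
            (\<exists>x. mono_path_from E g UNIV x K)"
          using Suc(1)[of b m K] 2 E sp 1 m by (simp add: N)
        then have "mono_path_from E g {b..?w} b m \<or> (\<exists>x. mono_path_from E g UNIV x K)"
          using long by blast
        then show ?thesis
          using mono_path_from_mono[of E g "{b..?w}" b m E "{b..?a}" m] by (auto simp: N)
      next
        case c: 2
        have "mono_path_from E g {?w..?z} ?w m \<or> mono_path_from E g {?w..?z} ?z K \<or>
            (\<exists>x. mono_path_from E g UNIV x K)"
          using Suc(1)[of ?w m K] 2 E sp c m by (simp add: N sub)
        then have "mono_path_from E g {?w..?z} ?w m \<or> (\<exists>x. mono_path_from E g UNIV x K)"
          using long by blast
        then show ?thesis
          using mono_path_from_mono[OF mono_path_from_Cons[of E g "{?w..?z}" ?w m b "{b..?a}"],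
              of E "{b..?a}" m] edges 2(4) c N(1) by (auto simp: N)
      next
        case 3
        \<comment> \<open>Two edges of colour \<open>c\<close> precede the last third, so the
          smaller demand \<open>m'\<close> suffices there; as \<open>?a\<close> is forced, the flag
          is \<open>True\<close> again.\<close>
        have "mono_path_from E g {?z..?a} ?z m' \<or> (\<exists>x. mono_path_from E g UNIV x K)"
          using Suc(2)[of ?z m'] 2 E sp 3 m by (simp add: N sub)
        moreover have "mono_path_from E g {b..?a} b m" if "mono_path_from E g {?z..?a} ?z m'"
        proof -
          have "mono_path_from E g {?w..?a} ?w (Suc m')"
            by (rule mono_path_from_Cons[OF that]) (use edges 3 N(1) in auto)
          then have "mono_path_from E g {b..?a} b (Suc (Suc m'))"
            by (rule mono_path_from_Cons) (use edges 3 2(4) N in auto)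
          then show ?thesis by (rule mono_path_from_mono) (auto simp: m)
        qed
        ultimately show ?thesis by (auto simp: N)
      qed
    qed }
qed

end

section \<open>The wheel\<close>

text \<open>As \<open>0 < k\<close>, every vertex of the path is an end of an edge.\<close>

lemma mono_path_from_restrict:
  assumes "mono_path_from E g UNIV x k" "0 < k" "E \<subseteq> A \<times> A"
  shows "mono_path_from E g A x k"
proof -
  obtain xs where xs: "distinct (x # xs)" "successively (\<lambda>u v. (u, v) \<in> E \<union> E\<inverse>) (x # xs)"
    "\<forall>u \<in> set xs. g u = g x" "k \<le> length xs"
    using assms(1) unfolding mono_path_from_def by blast
  have "set zs \<subseteq> A" if "successively (\<lambda>u v. (u, v) \<in> E \<union> E\<inverse>) zs" "2 \<le> length zs" for zs
    using that
  proof (induction zs rule: induct_list012)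
    case (3 u v zs)
    then show ?case using assms(3) by (cases zs) auto
  qed auto
  from this[OF xs(2)] show ?thesis
    unfolding mono_path_from_def using xs assms(2) by (intro exI[of _ xs]) auto
qed

lemma mono_path_from_run:
  assumes "strict_mono v" "\<And>i. i < K \<Longrightarrow> (v i, v (Suc i)) \<in> E" "\<And>i. i \<le> K \<Longrightarrow> g (v i) = d"
  shows "mono_path_from E g {v 0..} (v 0) K"
  using assms
proof (induction K arbitrary: v)
  case 0
  then show ?case by (simp add: mono_path_from_0)
next
  case (Suc K)
  have "mono_path_from E g {v (Suc 0)..} (v (Suc 0)) K"
    using Suc(1)[of "\<lambda>i. v (Suc i)"] Suc(2-) by (auto simp: strict_mono_Suc_iff)
  then show ?case
    using Suc(2) Suc(3)[of 0] Suc(4)[of 0] Suc(4)[of 1] strict_monoD[OF Suc(2), of 0 "Suc 0"]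
    by (elim mono_path_from_Cons) auto
qed

text \<open>The value of \<open>h\<close> at the midpoint \<open>K\<close> persists to the right if
  it is true and to the left if it is false.\<close>

lemma bool_run:
  assumes "\<And>k. k < 2 * K \<Longrightarrow> h k \<Longrightarrow> h (Suc k)"
  obtains j d where "j \<le> K" "\<And>i. i \<le> K \<Longrightarrow> h (j + i) = d"
proof (cases "h K")
  case True
  have "h (K + i)" if "i \<le> K" for i
    using that by (induction i) (use True assms in auto)
  then show ?thesis using that[of K True] by blast
next
  case False
  have below: "\<not> h (K - i)" if "i \<le> K" for i
    using that
  proof (induction i)
    case (Suc i)
    then have "K - Suc i < 2 * K" "Suc (K - Suc i) = K - i" by auto
    then show ?case using assms[of "K - Suc i"] Suc by auto
  qed (use False in auto)
  have "\<not> h i" if "i \<le> K" for i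
    using below[of "K - i"] that by simp
  then show ?thesis using that[of 0 False] by simp
qed

text \<open>The \<open>2 * K\<close> pieces in a row provide \<open>K\<close> consecutive outer
  edges on either side of the middle, and the depth pays for \<open>K\<close> extensions. Numbering
  starts at 1 because 0 is the hub.\<close>

definition rim :: "nat \<Rightarrow> (nat \<times> nat) set" where
  "rim K = (\<Union>k<2 * K. ternary (K * (K + 2)) (Suc (k * 3 ^ (K * (K + 2)))))"

definition rim_spokes :: "nat \<Rightarrow> nat set" where
  "rim_spokes K = (\<Union>k<2 * K. spokes False (K * (K + 2)) (Suc (k * 3 ^ (K * (K + 2)))))"

abbreviation hub_edges :: "nat \<Rightarrow> (nat \<times> nat) set" where
  "hub_edges K \<equiv> Pair 0 ` rim_spokes K"

definition wheel_size :: "nat \<Rightarrow> nat" where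
  "wheel_size K = 2 * K * 3 ^ (K * (K + 2)) + 2"

lemma chain_bounds:
  fixes N :: nat
  assumes "k < T" "Suc (k * N) \<le> p" "q \<le> Suc (k * N) + N"
  shows "0 < p" "q < T * N + 2"
proof -
  have "Suc k * N \<le> T * N" using assms(1) by (intro mult_right_mono) auto
  then show "q < T * N + 2" using assms(3) by simp
qed (use assms in simp)

lemma rim_bounds: "(p, q) \<in> rim K \<Longrightarrow> 0 < p \<and> p < q \<and> q < wheel_size K"
  using chain_bounds[of _ "2 * K" "3 ^ (K * (K + 2))" p q]
  by (auto simp: rim_def wheel_size_def dest: ternary_bounds)

lemma rim_spokes_bounds: "z \<in> rim_spokes K \<Longrightarrow> 0 < z \<and> z < wheel_size K"
  using chain_bounds[of _ "2 * K" "3 ^ (K * (K + 2))" z z]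
  by (auto simp: rim_spokes_def wheel_size_def dest!: spokes_bounds)

lemma noncrossing_rim: "noncrossing (rim K)"
proof -
  define n where "n = K * (K + 2)"
  have "noncrossing (\<Union>k<T. ternary n (Suc (k * 3 ^ n)))" for T
  proof (induction T)
    case (Suc T)
    show ?case
      unfolding lessThan_Suc Union_image_insert Un_commute[of "ternary n (Suc (T * 3 ^ n))"]
    proof (rule noncrossing_Un[OF Suc noncrossing_ternary, of _ _ "Suc (T * 3 ^ n)"])
      fix p q assume "(p, q) \<in> (\<Union>k<T. ternary n (Suc (k * 3 ^ n)))"
      then obtain k where "k < T" "q \<le> Suc (k * 3 ^ n) + 3 ^ n" by (auto dest: ternary_bounds)
      moreover from this have "Suc k * 3 ^ n \<le> T * 3 ^ n" by (intro mult_right_mono) auto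
      ultimately show "q \<le> Suc (T * 3 ^ n)" by simp
    qed (auto dest: ternary_bounds)
  qed (simp add: noncrossing_def)
  then show ?thesis by (simp add: rim_def n_def)
qed

lemma noncrossing_hub_edges: "noncrossing (hub_edges K)"
  by (auto simp: noncrossing_def dest: rim_spokes_bounds)

lemma rim_parity: "(p, q) \<in> rim K \<Longrightarrow> even p \<longleftrightarrow> odd q"
  by (auto simp: rim_def dest: ternary_parity)

lemma rim_spokes_independent:
  assumes "(p, q) \<in> rim K"
  shows "p \<notin> rim_spokes K \<or> q \<notin> rim_spokes K"
proof -
  define N :: nat where "N = 3 ^ (K * (K + 2))"
  obtain k where k: "(p, q) \<in> ternary (K * (K + 2)) (Suc (k * N))"
    using assms by (auto simp: rim_def N_def)
  note b = ternary_bounds[OF k, folded N_def]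
  \<comment> \<open>Spokes lie strictly inside their pieces, so a spoke in this closed interval
    cannot come from a neighbouring piece.\<close>
  have "u \<in> spokes False (K * (K + 2)) (Suc (k * N))"
    if u: "u \<in> rim_spokes K" "Suc (k * N) \<le> u" "u \<le> Suc (k * N) + N" for u
  proof -
    obtain k' where k': "u \<in> spokes False (K * (K + 2)) (Suc (k' * N))"
      using u(1) by (auto simp: rim_spokes_def N_def)
    note b' = spokes_bounds[OF k', folded N_def]
    have "k * N < Suc k' * N" "k' * N < Suc k * N" using b' u(2,3) by auto
    then have "k = k'" by (simp only: mult_less_cancel2) auto
    then show ?thesis using k' by simp
  qed
  then show ?thesis using spokes_independent(1)[OF k] b by auto
qed

text \<open>Suppose both alternatives fail. A piece whose left joint has the hub's colour then has
  it at its right joint too, as otherwise \<open>mono_path_from_ternary\<close> yields a long path.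
  So the joints change colour at most once along the chain, and the outer edges of half the chain
  form a long path after all.\<close>

lemma wheel_monochromatic:
  "(\<exists>z \<in> rim_spokes K. g z = g 0) \<or> (\<exists>x. mono_path_from (rim K) g UNIV x K)"
proof (rule disjCI)
  assume long: "\<nexists>x. mono_path_from (rim K) g UNIV x K"
  show "\<exists>z \<in> rim_spokes K. g z = g 0"
  proof (rule ccontr)
    assume "\<not> ?thesis"
    then have free: "\<forall>z \<in> rim_spokes K. g z = (\<not> g 0)" by auto
    define n where "n = K * (K + 2)"
    define v :: "nat \<Rightarrow> nat" where "v k = Suc (k * 3 ^ n)" for k
    have v_Suc: "v (Suc k) = v k + 3 ^ n" for k by (simp add: v_def)
    have sub: "ternary n (v k) \<subseteq> rim K" "spokes False n (v k) \<subseteq> rim_spokes K" if "k < 2 * K" for k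
      using that by (auto simp: rim_def rim_spokes_def v_def n_def)
    have step: "g (v (Suc k)) = g 0" if k: "k < 2 * K" "g (v k) = g 0" for k
    proof (rule ccontr)
      assume "g (v (Suc k)) \<noteq> g 0"
      then have "mono_path_from (rim K) g {v k..v k + 3 ^ n} (v k) K \<or>
          mono_path_from (rim K) g {v k..v k + 3 ^ n} (v k + 3 ^ n) K \<or>
          (\<exists>x. mono_path_from (rim K) g UNIV x K)"
        using k free sub[OF k(1)]
        by (intro mono_path_from_ternary(1)[where c = "g 0"]) (auto simp: v_Suc n_def)
      then show False using long mono_path_from_mono[of "rim K" g _ _ K "rim K" UNIV K] by blast
    qed
    obtain j d where j: "j \<le> K" and d: "\<And>i. i \<le> K \<Longrightarrow> (g (v (j + i)) = g 0) = d"
      using bool_run[of K "\<lambda>k. g (v k) = g 0"] step by blast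
    have "mono_path_from (rim K) g {v (j + 0)..} (v (j + 0)) K"
    proof (rule mono_path_from_run)
      show "strict_mono (\<lambda>i. v (j + i))" by (simp add: strict_mono_Suc_iff v_Suc)
      show "(v (j + i), v (j + Suc i)) \<in> rim K" if "i < K" for i
        using sub(1)[of "j + i"] ternary_outer[of "v (j + i)" n] that j by (auto simp: v_Suc)
      \<comment> \<open>\<open>d\<close> tells whether the run has the hub's colour; with two
        colours, \<open>g 0 = d\<close> is the colour itself.\<close>
      show "g (v (j + i)) = (g 0 = d)" if "i \<le> K" for i
        using d[OF that] by auto
    qed
    then show False using long mono_path_from_mono[of "rim K" g _ _ K "rim K" UNIV K] by blast
  qed
qed

section \<open>The tower of wheels\<close>

text \<open>Old vertices are scaled by \<open>M\<close>, and \<open>M * c + p\<close> is vertex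
  \<open>p\<close> of the new wheel at the old vertex \<open>c\<close>; its hub 0 is identified with
  \<open>M * c\<close>.\<close>

fun tower :: "nat \<Rightarrow> (nat \<times> nat) set \<Rightarrow> nat \<Rightarrow> (nat \<times> nat) set" where
  "tower M W 0 = {}"
| "tower M W (Suc j) = map_prod ((*) M) ((*) M) ` tower M W j \<union>
     (\<Union>c<M ^ j. map_prod ((+) (M * c)) ((+) (M * c)) ` W)"

text \<open>This lets rims and spokes be laid out on separate pages.\<close>

lemma tower_Un: "tower M (W \<union> W') j = tower M W j \<union> tower M W' j"
  by (induction j) auto

lemma subset_tower:
  assumes "0 < M" "0 < j"
  shows "W \<subseteq> tower M W j"
proof -
  obtain i where j: "j = Suc i" using assms(2) by (cases j) auto
  have "W \<subseteq> map_prod ((+) (M * 0)) ((+) (M * 0)) ` W" by force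
  also have "\<dots> \<subseteq> (\<Union>c<M ^ i. map_prod ((+) (M * c)) ((+) (M * c)) ` W)"
    using assms(1) by (intro UN_upper) simp
  finally show ?thesis unfolding j by auto
qed

lemma tower_bounds:
  assumes "W \<subseteq> {..<M} \<times> {..<M}" "0 < M"
  shows "tower M W j \<subseteq> {..<M ^ j} \<times> {..<M ^ j}"
proof (induction j)
  case (Suc j)
  have "M * c + p < M ^ Suc j" if "c < M ^ j" "p < M" for c p
  proof -
    have "M * c + p < M * Suc c" using that by simp
    also have "\<dots> \<le> M * M ^ j" using that by (intro mult_left_mono) auto
    finally show ?thesis by simp
  qed
  moreover have "M * p < M * M ^ j" if "p < M ^ j" for p
    using that assms(2) by simp
  ultimately show ?case using Suc assms by fastforce
qed simp

text \<open>Scaled edges end at multiples of \<open>M\<close>, whereas the copy of \<open>W\<close>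
  at \<open>c\<close> stays within \<open>M * c\<close> and \<open>M * Suc c\<close>, excluding the
  latter; so no multiple lies strictly inside one of its edges. Distinct copies occupy disjoint
  blocks.\<close>

lemma noncrossing_tower:
  assumes W: "noncrossing W" and WM: "W \<subseteq> {..<M} \<times> {..<M}" and M: "0 < M"
  shows "noncrossing (tower M W j)"
proof (induction j)
  case 0
  then show ?case by (simp add: noncrossing_def)
next
  case (Suc j)
  let ?T = "tower M W j"
  have cases: "(\<exists>p' q'. p = M * p' \<and> q = M * q' \<and> (p', q') \<in> ?T) \<or>
      (\<exists>c p' q'. p = M * c + p' \<and> q = M * c + q' \<and> (p', q') \<in> W \<and> q' < M)"
    if "(p, q) \<in> tower M W (Suc j)" for p q
    using that WM by auto
  have block: "\<not> (M * c + s < M * e \<and> M * e < M * c + r)" if "r < M" for c e r s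
  proof
    assume less: "M * c + s < M * e \<and> M * e < M * c + r"
    then have "M * e < M * Suc c" "M * c < M * e" using that by (simp, linarith)
    then show False by (simp only: mult_less_cancel1) auto
  qed
  have "\<not> (p < x \<and> x < q \<and> q < y)"
    if pq: "(p, q) \<in> tower M W (Suc j)" and xy: "(x, y) \<in> tower M W (Suc j)" for p q x y
  proof
    assume less: "p < x \<and> x < q \<and> q < y"
    from cases[OF pq] show False
    proof (elim disjE exE conjE)
      fix p' q' assume 1: "p = M * p'" "q = M * q'" "(p', q') \<in> ?T"
      from cases[OF xy] show False
      proof (elim disjE exE conjE)
        fix x' y' assume "x = M * x'" "y = M * y'" "(x', y') \<in> ?T"
        then show False using less 1 noncrossingD(2)[OF Suc 1(3), of x' y'] by simp
      next
        fix c x' y' assume "x = M * c + x'" "y = M * c + y'" "(x', y') \<in> W" "y' < M"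
        then show False using less 1 block[of y' c x' q'] by auto
      qed
    next
      fix c p' q' assume 1: "p = M * c + p'" "q = M * c + q'" "(p', q') \<in> W" "q' < M"
      from cases[OF xy] show False
      proof (elim disjE exE conjE)
        fix x' y' assume "x = M * x'" "y = M * y'" "(x', y') \<in> ?T"
        then show False using less 1 block[of q' c p' x'] by auto
      next
        fix e x' y' assume 2: "x = M * e + x'" "y = M * e + y'" "(x', y') \<in> W" "y' < M"
        have "M * c < M * Suc e" "M * e < M * Suc c" using less 1 2 by auto
        then have "c = e" by (simp only: mult_less_cancel1) auto
        then show False using less 1 2 noncrossingD(2)[OF W 1(3) 2(3)] by simp
      qed
    qed
  qed
  moreover have "p < q" if "(p, q) \<in> tower M W (Suc j)" for p q
    using cases[OF that] noncrossingD(1)[OF Suc, of "p div M" "q div M"]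
      noncrossingD(1)[OF W] M by auto
  ultimately show ?case unfolding noncrossing_def by blast
qed

section \<open>Excluding triangles\<close>

text \<open>A homomorphism to the 5-cycle on the residues modulo 5; only the residues of \<open>\<kappa>\<close> matter.\<close>

definition C5_colouring :: "(nat \<times> nat) set \<Rightarrow> (nat \<Rightarrow> int) \<Rightarrow> bool" where
  "C5_colouring E \<kappa> \<longleftrightarrow> (\<forall>(p, q) \<in> E. (\<kappa> p - \<kappa> q) mod 5 \<in> {1, 4})"

text \<open>Around a triangle the three differences add up to 0, but three summands 1 or -1 give an
  odd number between -3 and 3, never 0 modulo 5.\<close>

lemma C5_colouring_triangle_free:
  assumes "C5_colouring E \<kappa>" "(a, b) \<in> E \<union> E\<inverse>" "(b, c) \<in> E \<union> E\<inverse>" "(c, a) \<in> E \<union> E\<inverse>"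
  shows False
proof -
  have "(\<kappa> p - \<kappa> q) mod 5 \<in> {1, 4}" if "(p, q) \<in> E \<union> E\<inverse>" for p q
  proof -
    have "(\<kappa> p - \<kappa> q) mod 5 \<in> {1, 4} \<or> (\<kappa> q - \<kappa> p) mod 5 \<in> {1, 4}"
      using assms(1) that unfolding C5_colouring_def by auto
    moreover have "d mod 5 \<in> {1, 4}" if "- d mod 5 \<in> {1, 4}" for d :: int
      using that unfolding insert_iff empty_iff by presburger
    from this[of "\<kappa> p - \<kappa> q"]
    have "(\<kappa> p - \<kappa> q) mod 5 \<in> {1, 4}" if "(\<kappa> q - \<kappa> p) mod 5 \<in> {1, 4}"
      using that by simp
    ultimately show ?thesis by blast
  qed
  moreover have False
    if "(x - y) mod 5 \<in> {1, 4}" "(y - z) mod 5 \<in> {1, 4}" "(z - x) mod 5 \<in> {1, 4}" for x y z :: int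
    using that unfolding insert_iff empty_iff by presburger
  ultimately show False using assms(2-4) by blast
qed

text \<open>Each new wheel takes \<open>\<kappa>\<close> shifted by the colour of the vertex it
  hangs on; \<open>\<kappa> 0 = 0\<close> makes this fit at the hub.\<close>

lemma C5_colouring_tower:
  assumes "C5_colouring W \<kappa>" "\<kappa> 0 = 0" "W \<subseteq> {..<M} \<times> {..<M}" "0 < M"
  shows "\<exists>\<kappa>'. C5_colouring (tower M W j) \<kappa>'"
proof (induction j)
  case (Suc j)
  then obtain \<mu> where \<mu>: "C5_colouring (tower M W j) \<mu>" ..
  have "C5_colouring (tower M W (Suc j)) (\<lambda>x. \<mu> (x div M) + \<kappa> (x mod M))"
    using \<mu> assms unfolding C5_colouring_def by fastforce
  then show ?case by blast
qed (simp add: C5_colouring_def)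

lemma C5_colouring_wheel:
  "\<exists>\<kappa>. C5_colouring (rim K \<union> hub_edges K) \<kappa> \<and> \<kappa> 0 = 0"
proof -
  \<comment> \<open>On the 5-cycle, forced vertices go to the neighbours 1 and 4 of the hub's colour
    0. Along rim edges parity alternates and no two forced vertices meet, leaving the pairs 1-2, 2-3
    and 3-4.\<close>
  define \<kappa> :: "nat \<Rightarrow> int" where "\<kappa> x =
    (if x = 0 then 0 else if x \<in> rim_spokes K then (if even x then 4 else 1) else (if even x then 2 else 3))" for x
  have "(\<kappa> p - \<kappa> q) mod 5 \<in> {1, 4}" if "(p, q) \<in> rim K \<union> hub_edges K" for p q
    using that rim_parity[of p q K] rim_spokes_independent[of p q K] rim_bounds[of p q K]
      rim_spokes_bounds[of q K]
    by (auto simp: \<kappa>_def)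
  then have "C5_colouring (rim K \<union> hub_edges K) \<kappa>"
    unfolding C5_colouring_def by blast
  then show ?thesis by (auto simp: \<kappa>_def)
qed

section \<open>Monochromatic paths in the tower\<close>

text \<open>The induction colours an old vertex \<open>u\<close> by \<open>g (M * u)\<close>. The
  path obtained starts at \<open>x\<close>, so a spoke in the colour of its hub \<open>M * x\<close>
  can be put in front; failing that, the wheel itself has a path with \<open>K \<ge> Suc j\<close>
  edges.\<close>

lemma tower_monochromatic:
  assumes "0 < K" "j \<le> K"
  defines "M \<equiv> wheel_size K"
  shows "\<exists>x. mono_path_from (tower M (rim K \<union> hub_edges K) j) g {..<M ^ j} x j"
  using assms(2)
proof (induction j arbitrary: g)
  case 0
  then show ?case by (intro exI[of _ 0] mono_path_from_0) simp
next
  case (Suc j)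
  let ?W = "rim K \<union> hub_edges K"
  let ?T = "tower M ?W"
  have M: "2 \<le> M" by (simp add: M_def wheel_size_def)
  have W: "?W \<subseteq> {..<M} \<times> {..<M}"
    using M by (auto simp: M_def dest: rim_bounds rim_spokes_bounds)
  have block: "M * c + r < M ^ Suc j" if "c < M ^ j" "r < M" for c r
  proof -
    have "M * c + r < M * Suc c" using that by simp
    also have "\<dots> \<le> M * M ^ j" using that by (intro mult_left_mono) auto
    finally show ?thesis by simp
  qed
  obtain x where x: "mono_path_from (?T j) (\<lambda>u. g (M * u)) {..<M ^ j} x j"
    using Suc by force
  then have xlt: "x < M ^ j" by (auto simp: mono_path_from_def)
  have path: "mono_path_from (?T (Suc j)) g ((*) M ` {..<M ^ j}) (M * x) j"
    by (rule mono_path_from_map[OF x]) (use M in \<open>auto simp: inj_on_def\<close>)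
  let ?h = "\<lambda>u. M * x + u"
  have h: "(?h u, ?h v) \<in> ?T (Suc j)" if "(u, v) \<in> ?W" for u v
    using that xlt by force
  from wheel_monochromatic[of K "\<lambda>u. g (?h u)"] show ?case
  proof
    assume "\<exists>z \<in> rim_spokes K. g (?h z) = g (?h 0)"
    then obtain z where z: "z \<in> rim_spokes K" "g (?h z) = g (M * x)" by auto
    have z': "0 < z" "z < M" using rim_spokes_bounds[OF z(1)] by (auto simp: M_def)
    have "mono_path_from (?T (Suc j)) g {..<M ^ Suc j} (?h z) (Suc j)"
    proof (rule mono_path_from_Cons[OF path])
      show "(?h z, M * x) \<in> ?T (Suc j) \<union> (?T (Suc j))\<inverse>"
        using h[of 0 z] z by auto
      show "?h z \<notin> (*) M ` {..<M ^ j}"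
      proof
        assume "?h z \<in> (*) M ` {..<M ^ j}"
        then obtain e where e: "M * x + z = M * e" by auto
        have "(M * x + z) mod M = 0" unfolding e by simp
        then show False using z' by simp
      qed
      show "insert (?h z) ((*) M ` {..<M ^ j}) \<subseteq> {..<M ^ Suc j}"
        using block[OF xlt z'(2)] block[of _ 0] M by auto
    qed (use z in auto)
    then show ?case by blast
  next
    assume "\<exists>y. mono_path_from (rim K) (\<lambda>u. g (?h u)) UNIV y K"
    then obtain y where y: "mono_path_from (rim K) (\<lambda>u. g (?h u)) {..<M} y K"
      using mono_path_from_restrict[of "rim K" _ _ K "{..<M}"] assms(1) W by blast
    have "mono_path_from (?T (Suc j)) g (?h ` {..<M}) (?h y) K"
      by (rule mono_path_from_map[OF y]) (use h in auto)
    then have "mono_path_from (?T (Suc j)) g {..<M ^ Suc j} (?h y) (Suc j)"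
      by (rule mono_path_from_mono) (use block[OF xlt] Suc(2) in auto)
    then show ?case by blast
  qed
qed

section \<open>Planarity of two-page layouts\<close>

text \<open>Over the abscissa \<open>x\<close> this is the parabola
  \<open>h * (x - p) * (q - x)\<close>; the square factor gives it leading coefficient
  \<open>- h\<close> whatever the length of the edge.\<close>

definition bump :: "real \<Rightarrow> nat \<Rightarrow> nat \<Rightarrow> real \<Rightarrow> complex" where
  "bump h p q s = Complex (p + s * (real q - p)) (h * (s * (1 - s) * (real q - p)\<^sup>2))"

lemma bump_simps [simp]: "bump h p q 0 = of_nat p" "bump h p q 1 = of_nat q"
  by (simp_all add: bump_def complex_eq_iff)

lemma arc_bump:
  assumes "p \<noteq> q"
  shows "arc (bump h p q)"
  using assms
  by (auto simp: arc_def path_def bump_def inj_on_def complex_eq_iff Complex_eq intro!: continuous_intros)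

lemma path_image_bump:
  assumes "w \<in> path_image (bump h p q)" "p < q"
  shows "real p \<le> Re w" "Re w \<le> real q" "Im w = h * ((Re w - p) * (q - Re w))"
proof -
  obtain s where s: "0 \<le> s" "s \<le> 1" "w = bump h p q s"
    using assms(1) by (auto simp: path_image_def)
  have "0 \<le> s * (real q - real p)" "s * (real q - real p) \<le> real q - real p"
    using s assms(2) by (auto intro: mult_left_le_one_le)
  moreover have "Re w = p + s * (real q - p)"
    by (simp add: s(3) bump_def)
  ultimately have "real p \<le> Re w \<and> Re w \<le> real q" by linarith
  then show "real p \<le> Re w" "Re w \<le> real q" by auto
  show "Im w = h * ((Re w - p) * (q - Re w))"
    unfolding s(3) bump_def by (simp add: algebra_simps power2_eq_square)
qed

text \<open>Over a common interior point of nested intervals, the outer edge has both factors of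
  \<open>(x - p) * (q - x)\<close> at least as large and one strictly larger, so equal heights are
  impossible.\<close>

lemma bumps_disjoint:
  assumes E: "noncrossing E" "(p, q) \<in> E" "(x, y) \<in> E" "(p, q) \<noteq> (x, y)" and h: "h \<noteq> 0"
    and w: "w \<in> path_image (bump h p q)" "w \<in> path_image (bump h x y)"
  shows "w \<in> {of_nat p, of_nat q}"
proof -
  have less: "p < q" "x < y" using noncrossingD(1)[OF E(1)] E(2,3) by auto
  note P = path_image_bump[OF w(1) less(1)] and X = path_image_bump[OF w(2) less(2)]
  let ?r = "Re w"
  have eq: "(?r - p) * (q - ?r) = (?r - x) * (y - ?r)" using P(3) X(3) h by simp
  have strict: False if "a \<le> c" "d \<le> b" "(a, b) \<noteq> (c, d)" "real c < ?r" "?r < d"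
      "(?r - a) * (b - ?r) = (?r - c) * (d - ?r)" for a b c d :: nat
  proof -
    have "a < c \<or> d < b" using that(1-3) by auto
    then have "(?r - c) * (d - ?r) < (?r - a) * (b - ?r)"
    proof
      assume "a < c"
      then show ?thesis using that(2,4,5) by (intro mult_less_le_imp_less) auto
    next
      assume "d < b"
      then show ?thesis using that(1,4,5) by (intro mult_le_less_imp_less) auto
    qed
    then show False using that(6) by simp
  qed
  have "?r = p \<or> ?r = q"
  proof (rule ccontr)
    assume "\<not> ?thesis"
    then have r: "real p < ?r" "?r < q" using P by auto
    then have "0 < (?r - p) * (q - ?r)" by simp
    then have "?r \<noteq> x" "?r \<noteq> y" unfolding eq by auto
    then have r': "real x < ?r" "?r < y" using X by auto
    have "x < q" "p < y" using r r' by auto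
    then have "p \<le> x \<and> y \<le> q \<or> x \<le> p \<and> q \<le> y"
      using noncrossingD(2)[OF E(1,2), of x y] noncrossingD(2)[OF E(1,3), of p q] E(2,3) by linarith
    then show False
      using strict[of p x y q] strict[of x p q y] r r' eq E(4) by auto
  qed
  then show ?thesis using P(3) by (auto simp: complex_eq_iff)
qed

text \<open>Curves on different sides of the axis can meet only on it, and each curve touches it
  just at its ends.\<close>

lemma planar_two_pages:
  fixes G :: "nat pair_pre_digraph"
  assumes U: "noncrossing U" and L: "noncrossing L"
    and arcs: "parcs G = (U \<union> L) \<union> (U \<union> L)\<inverse>"
  shows "planar G"
proof -
  define h :: "nat \<Rightarrow> nat \<Rightarrow> real" where "h p q = (if (p, q) \<in> U then 1 else - 1)" for p q
  \<comment> \<open>The curve receives an unordered pair; \<open>Min\<close> and \<open>Max\<close>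
    recover its left and right end.\<close>
  define \<gamma> where "\<gamma> e = bump (h (Min e) (Max e)) (Min e) (Max e)" for e
  have \<gamma>: "\<gamma> {p, q} = bump (h p q) p q" if "p < q" for p q
    using that by (simp add: \<gamma>_def min_def max_def)
  have edge: "\<exists>p q. {u, v} = {p, q} \<and> p < q \<and> (p, q) \<in> U \<union> L" if "(u, v) \<in> parcs G" for u v
    using that noncrossingD(1)[OF U] noncrossingD(1)[OF L] unfolding arcs by blast
  have interior: "Im w \<noteq> 0" "w \<noteq> of_nat z"
    if "w \<in> path_image (bump (h p q) p q)" "w \<notin> {of_nat p, of_nat q}" "p < q" for w p q z
  proof -
    note P = path_image_bump[OF that(1,3)]
    have "Re w \<noteq> p \<and> Re w \<noteq> q" using P(3) that(2) by (auto simp: complex_eq_iff)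
    then show "Im w \<noteq> 0" using P(3) by (auto simp: h_def)
    then show "w \<noteq> of_nat z" by auto
  qed
  have disjoint: "w \<notin> path_image (bump (h x y) x y)"
    if "(p, q) \<in> U \<union> L" "(x, y) \<in> U \<union> L" "p < q" "x < y" "(p, q) \<noteq> (x, y)"
      "w \<in> path_image (bump (h p q) p q)" "w \<notin> {of_nat p, of_nat q}" for w p q x y
  proof
    assume w: "w \<in> path_image (bump (h x y) x y)"
    note P = path_image_bump[OF that(6,3)] and X = path_image_bump[OF w that(4)]
    \<comment> \<open>A common point off the axis forces equal signs, so both edges lie on one page
      and \<open>bumps_disjoint\<close> applies.\<close>
    have sign: "s = s'" if "s * a = s' * b" "s * a \<noteq> 0" "0 \<le> a" "0 \<le> b" "s \<in> {1, -1}" "s' \<in> {1, -1}"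
      for s s' a b :: real
      using that by auto
    have "0 \<le> (Re w - p) * (q - Re w)" "0 \<le> (Re w - x) * (y - Re w)" using P X by auto
    moreover have "h p q * ((Re w - p) * (q - Re w)) \<noteq> 0"
      using interior(1)[OF that(6,7,3)] P(3) by simp
    ultimately have h_eq: "h p q = h x y"
      by (intro sign[OF trans[OF P(3)[symmetric] X(3)]]) (auto simp: h_def)
    then have "(p, q) \<in> U \<and> (x, y) \<in> U \<or> (p, q) \<in> L \<and> (x, y) \<in> L"
      using that(1,2) by (auto simp: h_def split: if_splits)
    moreover have "h p q \<noteq> 0" by (simp add: h_def)
    ultimately show False
      using bumps_disjoint[OF U _ _ that(5), of "h p q" w] bumps_disjoint[OF L _ _ that(5), of "h p q" w]
        that(6,7) w h_eq by auto
  qed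
  have "plane_drawing G of_nat \<gamma>"
    unfolding plane_drawing_def
  proof (intro conjI ballI; (clarify)?)
    show "inj_on (of_nat :: nat \<Rightarrow> complex) (pverts G)" by (simp add: inj_on_def)
  next
    fix u v assume "(u, v) \<in> parcs G"
    from edge[OF this] obtain p q where pq: "{u, v} = {p, q}" "p < q" "(p, q) \<in> U \<union> L" by blast
    have "{of_nat u, of_nat v} = (of_nat ` {p, q} :: complex set)" unfolding pq(1)[symmetric] by simp
    then have ends: "{of_nat u, of_nat v} = {of_nat p, of_nat q :: complex}" by simp
    show "arc (\<gamma> {u, v}) \<and> {pathstart (\<gamma> {u, v}), pathfinish (\<gamma> {u, v})} = {of_nat u, of_nat v} \<and>
        edge_interior of_nat \<gamma> u v \<inter> of_nat ` pverts G = {}"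
      unfolding edge_interior_def pq(1) ends \<gamma>[OF pq(2)]
    proof (intro conjI)
      show "arc (bump (h p q) p q)" by (rule arc_bump) (use pq(2) in simp)
      show "(path_image (bump (h p q) p q) - {of_nat p, of_nat q}) \<inter> of_nat ` pverts G = {}"
      proof (rule equals0I, elim IntE DiffE imageE)
        fix w z assume "w \<in> path_image (bump (h p q) p q)" "w \<notin> {of_nat p, of_nat q}" "w = of_nat z"
        then show False using interior(2)[of w p q z] pq(2) by simp
      qed
    qed (simp add: pathstart_def pathfinish_def)
  next
    fix u v x y assume "(u, v) \<in> parcs G" "(x, y) \<in> parcs G" and ne: "{u, v} \<noteq> {x, y}"
    then obtain p q a b where pq: "{u, v} = {p, q}" "p < q" "(p, q) \<in> U \<union> L"
      and ab: "{x, y} = {a, b}" "a < b" "(a, b) \<in> U \<union> L" using edge by meson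
    have "{of_nat u, of_nat v} = (of_nat ` {p, q} :: complex set)" unfolding pq(1)[symmetric] by simp
    then have ends: "{of_nat u, of_nat v} = {of_nat p, of_nat q :: complex}" by simp
    have "(p, q) \<noteq> (a, b)" using ne pq ab by auto
    then show "edge_interior of_nat \<gamma> u v \<inter> path_image (\<gamma> {x, y}) = {}"
      unfolding edge_interior_def pq(1) ab(1) ends \<gamma>[OF pq(2)] \<gamma>[OF ab(2)]
      using disjoint[OF pq(3) ab(3) pq(2) ab(2)] by blast
  qed
  then show ?thesis unfolding planar_def by blast
qed

section \<open>Girth and graph paths\<close>

lemma girth_eq_4:
  fixes G :: "nat pair_pre_digraph"
  assumes G: "pair_graph G"
    and free: "\<And>a b c. \<lbrakk>(a, b) \<in> parcs G; (b, c) \<in> parcs G; (c, a) \<in> parcs G\<rbrakk> \<Longrightarrow> False"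
    and square: "(a, b) \<in> parcs G" "(b, c) \<in> parcs G" "(c, d) \<in> parcs G" "(d, a) \<in> parcs G"
      "distinct [a, b, c, d]"
  shows "girth G = 4"
proof -
  interpret pair_graph G by (rule G)
  have "cycle [(a, b), (b, c), (c, d), (d, a)]"
    unfolding cycle_def awalk_def using square arc_fst_in_verts[OF square(1)]
    by (intro exI[of _ a]) auto
  then have "girth G \<le> enat (length [(a, b), (b, c), (c, d), (d, a)])"
    unfolding girth_def by (intro INF_lower) auto
  moreover have "4 \<le> enat (length p)" if p: "cycle p" "3 \<le> length p" for p
  proof -
    \<comment> \<open>The arcs of a cycle of length 3 would form a triangle.\<close>
    have "length p \<noteq> 3"
    proof
      assume "length p = 3"
      then obtain e1 e2 e3 where e: "p = [e1, e2, e3]" by (auto simp: numeral_3_eq_3 length_Suc_conv)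
      obtain u where "awalk u p u" using p(1) unfolding cycle_def by blast
      then show False
        using free[of "fst e1" "fst e2" "fst e3"] unfolding e awalk_def
        by (cases e1; cases e2; cases e3) auto
    qed
    then show ?thesis using p(2) by (simp add: numeral_eq_enat)
  qed
  then have "4 \<le> girth G" unfolding girth_def by (intro INF_greatest) auto
  ultimately show ?thesis by (intro antisym) (simp_all add: numeral_eq_enat numeral_eq_Suc)
qed

text \<open>The induction on \<open>k\<close> follows the list for exactly \<open>k\<close> edges
  and drops the rest.\<close>

lemma has_monochromatic_path_if_mono_path_from:
  fixes G :: "nat pair_pre_digraph"
  assumes G: "pair_graph G" and arcs: "parcs G = E \<union> E\<inverse>"
    and path: "mono_path_from E f (pverts G) x k"
  shows "has_monochromatic_path G f k"
proof -
  interpret pair_graph G by (rule G)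
  have "\<exists>p v. apath x p v \<and> length p = k \<and> set (awalk_verts x p) \<subseteq> set (x # xs)"
    if "distinct (x # xs)" "successively (\<lambda>u v. (u, v) \<in> E \<union> E\<inverse>) (x # xs)"
      "set (x # xs) \<subseteq> pverts G" "k \<le> length xs" for x xs
    using that
  proof (induction k arbitrary: x xs)
    case 0
    then show ?case by (intro exI[of _ "[]"]) (auto simp: apath_Nil_iff)
  next
    case (Suc k)
    then obtain y ys where xs: "xs = y # ys" by (cases xs) auto
    obtain p v where p: "apath y p v" "length p = k" "set (awalk_verts y p) \<subseteq> set (y # ys)"
      using Suc(1)[of y ys] Suc(2-) xs by auto
    have "apath x ((x, y) # p) v"
      using p Suc(2,3) xs arcs by (auto simp: apath_Cons_iff)
    then show ?case
      using p xs by (intro exI[of _ "(x, y) # p"] exI[of _ v]) auto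
  qed
  then obtain xs p v where "apath x p v" "length p = k" "set (awalk_verts x p) \<subseteq> set (x # xs)"
      and "\<forall>u \<in> set xs. f u = f x"
    using path unfolding mono_path_from_def by meson
  moreover from this have "\<forall>u \<in> set (awalk_verts x p). f u = f x" by auto
  ultimately show ?thesis
    unfolding has_monochromatic_path_def monochromatic_def
    by (intro exI[of _ x] exI[of _ p] exI[of _ v]) auto
qed

text \<open>This is the outermost 4-cycle of the first piece; \<open>0 < K\<close> ensures that
  there is a piece and that its depth is positive.\<close>

lemma wheel_square:
  assumes "0 < K"
  obtains a b c d where "(a, b) \<in> rim K" "(b, c) \<in> rim K" "(c, d) \<in> rim K" "(a, d) \<in> rim K"
    "distinct [a, b, c, d]"
proof -
  have triple: "3 * x = x + x + x" for x :: nat by simp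
  obtain n where n: "K * (K + 2) = Suc n" using assms by (cases "K * (K + 2)") auto
  have "ternary (K * (K + 2)) (Suc (0 * 3 ^ (K * (K + 2)))) \<subseteq> rim K"
    unfolding rim_def using assms by (intro UN_upper) simp
  then have "ternary (Suc n) 1 \<subseteq> rim K" unfolding n by (simp del: ternary.simps)
  moreover have "(1, 1 + 3 ^ n) \<in> ternary (Suc n) 1" "(1, 1 + 3 * 3 ^ n) \<in> ternary (Suc n) 1"
      "(1 + 3 ^ n, 1 + 2 * 3 ^ n) \<in> ternary (Suc n) 1"
      "(1 + 2 * 3 ^ n, 1 + 3 * 3 ^ n) \<in> ternary (Suc n) 1"
    using ternary_outer[of 1 n] ternary_outer[of "1 + 3 ^ n" n] ternary_outer[of "1 + 2 * 3 ^ n" n]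
    by (simp_all add: mult_2 triple)
  ultimately show ?thesis by (intro that[of 1 "1 + 3 ^ n" "1 + 2 * 3 ^ n" "1 + 3 * 3 ^ n"]) auto
qed

section \<open>Assembling the graph\<close>

theorem theorem2:
  fixes t :: nat
  assumes "0 < t"
  shows "\<exists>G :: nat pair_pre_digraph.
           pair_graph G \<and> planar G \<and> girth G = 4 \<and>
           (\<forall>f :: nat \<Rightarrow> bool. has_monochromatic_path G f (t - 1))"
proof -
  let ?M = "wheel_size t" and ?W = "rim t \<union> hub_edges t"
  \<comment> \<open>Height \<open>t\<close> gives \<open>t\<close> edges, one more than asked; for
    \<open>t = 1\<close>, height \<open>t - 1\<close> would leave no edges and hence no 4-cycle.
    Wheels with \<open>K = t\<close> serve all heights up to \<open>t\<close>.\<close>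
  define E where "E = tower ?M ?W t"
  define G where "G = \<lparr>pverts = {..<?M ^ t}, parcs = E \<union> E\<inverse>\<rparr>"
  have M: "0 < ?M" by (simp add: wheel_size_def)
  have WM: "rim t \<subseteq> {..<?M} \<times> {..<?M}" "hub_edges t \<subseteq> {..<?M} \<times> {..<?M}"
    using M by (auto dest: rim_bounds rim_spokes_bounds)
  then have "E \<subseteq> {..<?M ^ t} \<times> {..<?M ^ t}"
    unfolding E_def by (intro tower_bounds) (use M in auto)
  then have fin: "finite E" and E_verts: "E \<union> E\<inverse> \<subseteq> {..<?M ^ t} \<times> {..<?M ^ t}"
    by (auto intro: finite_subset)
  have pages: "noncrossing (tower ?M (rim t) t)" "noncrossing (tower ?M (hub_edges t) t)"
    using noncrossing_tower noncrossing_rim noncrossing_hub_edges WM M by auto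
  have E_Un: "E = tower ?M (rim t) t \<union> tower ?M (hub_edges t) t"
    unfolding E_def by (rule tower_Un)
  have loopfree: "p \<noteq> q" if "(p, q) \<in> E \<union> E\<inverse>" for p q
    using that noncrossingD(1)[OF pages(1)] noncrossingD(1)[OF pages(2)] unfolding E_Un by blast
  have G: "pair_graph G"
    using fin E_verts loopfree by unfold_locales (auto simp: G_def symmetric_def intro!: symI)
  moreover have "planar G"
    using pages by (rule planar_two_pages) (simp add: G_def E_Un)
  moreover have "girth G = 4"
  proof -
    have "?W \<subseteq> {..<?M} \<times> {..<?M}" using WM by blast
    then obtain \<kappa> where "C5_colouring E \<kappa>"
      using C5_colouring_wheel[of t] C5_colouring_tower[of ?W _ ?M t] M unfolding E_def by blast
    then have free: False if "(a, b) \<in> parcs G" "(b, c) \<in> parcs G" "(c, a) \<in> parcs G" for a b c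
      using that unfolding G_def by (intro C5_colouring_triangle_free[of E \<kappa> a b c]) simp_all
    obtain a b c d where "(a, b) \<in> rim t" "(b, c) \<in> rim t" "(c, d) \<in> rim t" "(a, d) \<in> rim t"
      "distinct [a, b, c, d]" using wheel_square[OF assms] .
    moreover have "rim t \<subseteq> E"
      using subset_tower[OF M assms, of ?W] unfolding E_def by blast
    ultimately have "(a, b) \<in> parcs G" "(b, c) \<in> parcs G" "(c, d) \<in> parcs G" "(d, a) \<in> parcs G"
      "distinct [a, b, c, d]" by (auto simp: G_def)
    from G free this show ?thesis by (rule girth_eq_4)
  qed
  moreover have "has_monochromatic_path G f (t - 1)" for f :: "nat \<Rightarrow> bool"
  proof -
    obtain x where "mono_path_from E f {..<?M ^ t} x t"
      using tower_monochromatic[OF assms order.refl] unfolding E_def by blast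
    then have "mono_path_from E f (pverts G) x (t - 1)"
      by (rule mono_path_from_mono) (auto simp: G_def)
    then show ?thesis
      by (intro has_monochromatic_path_if_mono_path_from[OF G]) (auto simp: G_def)
  qed
  ultimately show ?thesis by blast
qed

end
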